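(* For every positive integer $m$, $$\mathrm{forb}(m,F(0,6,1,0))\le \Big\lfloor \tfrac{21}{5}m\Big\rfloor+1,$$ with equality only for $m\equiv 0 \pmod 5$. Moreover, $\mathrm{forb}(m,F(0,6,1,0))=\lfloor \tfrac{21}{5}m\rfloor$ for all $m\equiv 1\pmod 5$ with $m\ge 6$.
   Context: A matrix is simple if it is a $(0,1)$-matrix with no repeated columns. For $(0,1)$-matrices $F,A$, $F$ is a configuration in $A$ (written $F\prec A$) if some submatrix of $A$ is a row and column permutation of $F$. $\mathrm{Avoid}(m,F)$ is the set of all simple $m$-rowed matrices $A$ with $F\not\prec A$, and $\mathrm{forb}(m,F)$ is the maximum number of columns of a matrix in $\mathrm{Avoid}(m,F)$. For $p\ge 1$, $F(0,p,1,0)$ is the $2\times(p+1)$ matrix whose first $p$ columns are $\binom{1}{0}$ and whose last column is $\binom{0}{1}$ (a row with $p$ ones and a row with a single one in the remaining column). *)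

theory Defs
  imports "HOL-Combinatorics.Permutations" "Jordan_Normal_Form.DL_Submatrix"
begin

definition simple_matrix :: "int mat \<Rightarrow> bool" where
  "simple_matrix A \<longleftrightarrow> elements_mat A \<subseteq> {0, 1} \<and> distinct (cols A)"

text \<open>\<^term>\<open>submatrix A I J\<close> keeps the rows \<^term>\<open>I\<close> and the columns \<^term>\<open>J\<close> in their
  original order; rows and columns are indexed from 0.\<close>

definition row_col_permutation :: "'a mat \<Rightarrow> 'a mat \<Rightarrow> bool" where
  "row_col_permutation B F \<longleftrightarrow>
     (\<exists>p q. p permutes {..<dim_row F} \<and> q permutes {..<dim_col F} \<and>
        B = mat (dim_row F) (dim_col F) (\<lambda>(i, j). F $$ (p i, q j)))"

definition configuration_in :: "'a mat \<Rightarrow> 'a mat \<Rightarrow> bool" where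
  "configuration_in F A \<longleftrightarrow>
     (\<exists>I J. I \<subseteq> {..<dim_row A} \<and> J \<subseteq> {..<dim_col A} \<and>
        row_col_permutation (submatrix A I J) F)"

definition Avoid :: "nat \<Rightarrow> int mat \<Rightarrow> int mat set" where
  "Avoid m F = {A. simple_matrix A \<and> dim_row A = m \<and> \<not> configuration_in F A}"

definition forb :: "nat \<Rightarrow> int mat \<Rightarrow> nat" where
  "forb m F = Max (dim_col ` Avoid m F)"

definition F0p10 :: "nat \<Rightarrow> int mat" where
  "F0p10 p = mat 2 (p + 1)
     (\<lambda>(i, j). if j < p then (if i = 0 then 1 else 0) else (if i = 0 then 0 else 1))"

text \<open>The maximum in the definition of \<^const>\<open>forb\<close> is over a finite set, which is nonempty as
  soon as \<^term>\<open>F\<close> has a column: the matrix without columns then avoids \<^term>\<open>F\<close>.\<close>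

lemma finite_dim_col_Avoid: "finite (dim_col ` Avoid m F)"
proof -
  let ?V = "vec_of_list ` {xs. set xs \<subseteq> {0, 1 :: int} \<and> length xs = m}"
  have fin: "finite ?V"
    by (intro finite_imageI finite_lists_length_eq) simp
  have "dim_col A \<le> card ?V" if A: "A \<in> Avoid m F" for A
  proof -
    have el: "elements_mat A \<subseteq> {0, 1}" and d: "distinct (cols A)" and r: "dim_row A = m"
      using A by (auto simp: Avoid_def simple_matrix_def)
    have "set (cols A) \<subseteq> ?V"
    proof
      fix v assume "v \<in> set (cols A)"
      then obtain j where j: "j < dim_col A" "v = col A j"
        by (auto simp: cols_def)
      have "A $$ (i, j) \<in> elements_mat A" if "i < m" for i
        using elements_matI[OF carrier_matI[OF r refl] that j(1) refl] .
      then have "set (list_of_vec v) \<subseteq> {0, 1}"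
        using el j r by (fastforce simp: set_list_of_vec vec_set_def)
      moreover have "length (list_of_vec v) = m"
        using j r by simp
      ultimately show "v \<in> ?V"
        by (intro image_eqI[of _ _ "list_of_vec v"]) (auto simp: vec_list)
    qed
    then show ?thesis
      using card_mono[OF fin \<open>set (cols A) \<subseteq> ?V\<close>] distinct_card[OF d] cols_length[of A] by linarith
  qed
  then show ?thesis
    by (auto simp: finite_nat_set_iff_bounded_le)
qed

lemma Avoid_nonempty:
  assumes "dim_col F > 0"
  shows "Avoid m F \<noteq> {}"
proof -
  have "\<not> configuration_in F (mat m 0 (\<lambda>_. 0))"
  proof
    assume "configuration_in F (mat m 0 (\<lambda>_. 0))"
    then obtain I J where "row_col_permutation (submatrix (mat m 0 (\<lambda>_. 0)) I J) F"
      unfolding configuration_in_def by blast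
    then have "dim_col (submatrix (mat m 0 (\<lambda>_. 0 :: int)) I J) = dim_col F"
      unfolding row_col_permutation_def by (metis dim_col_mat(1))
    with assms show False
      by (simp add: dim_submatrix)
  qed
  then have "mat m 0 (\<lambda>_. 0) \<in> Avoid m F"
    by (simp add: Avoid_def simple_matrix_def elements_mat_def cols_def)
  then show ?thesis by blast
qed

end

theory Submission
  imports Defs
begin

text \<open>Read the columns of a matrix as sets of rows, and let the degree of a row be the number of
  columns containing it. If two rows differ by at least 5 in degree, the one of smaller degree is
  contained in the other, as otherwise the excluded configuration occurs. So a gap of length 5 in the
  sequence of degrees cuts the rows into two parts, every column is empty on the lower part or full on
  the upper one, and induction applies to the traces on both parts. If there is no such gap, let \<open>D\<close>
  be the difference of the extreme degrees. For \<open>D \<le> 4\<close> every ordered pair of rows is separated by at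
  most 5 columns, and double counting \<open>\<bar>C\<bar> (m - \<bar>C\<bar>)\<close>, where at most \<open>2 m\<close> columns contribute
  \<open>m - 1\<close> and the other nonconstant ones at least \<open>2 (m - 2)\<close>, gives the bound. For \<open>D \<ge> 5\<close> the
  number of columns is \<open>D\<close> plus the number of columns missing the row of largest degree plus the
  number of columns containing the row of smallest degree. The last two are small because only rows
  of nearly extreme degree matter for them, and the absence of gaps bounds \<open>D\<close> by 4 times the
  number of rows needed to cover the remaining range of degrees. The extremal families are ordinal
  sums of one block with 6 rows and 25 columns and of blocks with 5 rows and 22 columns.\<close>

section \<open>Families avoiding a configuration\<close>

definition separating :: "'a set set \<Rightarrow> 'a \<Rightarrow> 'a \<Rightarrow> 'a set set" where
  "separating F x y = {C \<in> F. x \<in> C \<and> y \<notin> C}"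

text \<open>The set form of avoiding \<open>F0p10 p\<close>: its \<open>p\<close> columns with
  entries 1, 0 are counted by \<open>separating F x y\<close>, its last column lies in
  \<open>separating F y x\<close>. Quantifying over ordered pairs accounts for row permutations, and
  \<open>x = y\<close> is harmless because nothing separates a row from itself.\<close>

definition avoiding :: "nat \<Rightarrow> 'a set \<Rightarrow> 'a set set \<Rightarrow> bool" where
  "avoiding p V F \<longleftrightarrow> finite V \<and> F \<subseteq> Pow V \<and>
     (\<forall>x\<in>V. \<forall>y\<in>V. p \<le> card (separating F x y) \<longrightarrow> separating F y x = {})"

definition degree :: "'a set set \<Rightarrow> 'a \<Rightarrow> nat" where
  "degree F x = card {C \<in> F. x \<in> C}"

lemma avoiding_finite:
  assumes "avoiding p V F"
  shows "finite V" "finite F" "finite (separating F x y)"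
proof -
  show "finite V" "finite F"
    using assms by (auto simp: avoiding_def intro: finite_subset[of _ "Pow V"])
  then show "finite (separating F x y)"
    by (simp add: separating_def)
qed

lemma avoiding_card_less:
  assumes "avoiding p V F" "x \<in> V" "y \<in> V" "separating F y x \<noteq> {}"
  shows "card (separating F x y) < p"
proof -
  have "p \<le> card (separating F x y) \<longrightarrow> separating F y x = {}"
    using assms(1-3) unfolding avoiding_def by blast
  with assms(4) show ?thesis by linarith
qed

lemma card_filter_add_card_filter_not:
  assumes "finite A"
  shows "card {a \<in> A. P a} + card {a \<in> A. \<not> P a} = card A"
proof -
  have "{a \<in> A. P a} \<union> {a \<in> A. \<not> P a} = A"
    by blast
  then show ?thesis
    using assms card_Un_disjoint[of "{a \<in> A. P a}" "{a \<in> A. \<not> P a}"] by fastforce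
qed

text \<open>Both sides count the members of \<open>F\<close> that contain \<open>x\<close> or
  \<open>y\<close>. Hence a difference of degrees is a difference of separation numbers.\<close>

lemma separating_degree:
  assumes "finite F"
  shows "card (separating F x y) + degree F y = card (separating F y x) + degree F x"
proof -
  have "card (separating F x y) + degree F y = card ({C \<in> F. x \<in> C \<or> y \<in> C})" for x y
  proof -
    have "{C \<in> F. x \<in> C \<or> y \<in> C} = separating F x y \<union> {C \<in> F. y \<in> C}"
      by (auto simp: separating_def)
    moreover have "separating F x y \<inter> {C \<in> F. y \<in> C} = {}" "finite (separating F x y)"
      using assms by (auto simp: separating_def)
    ultimately show ?thesis
      using assms by (simp add: card_Un_disjoint degree_def)
  qed
  from this[of x y] this[of y x] show ?thesis
    by (simp only: disj_commute)
qed

lemma separating_image: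
  assumes "\<And>C. C \<in> F \<Longrightarrow> x \<in> f C \<longleftrightarrow> x' \<in> C" and "\<And>C. C \<in> F \<Longrightarrow> y \<in> f C \<longleftrightarrow> y' \<in> C"
  shows "separating (f ` F) x y = f ` separating F x' y'"
  using assms by (auto simp: separating_def)

text \<open>Restricting to \<open>X\<close> may merge members, but merging only lowers separation
  numbers and creates no separation where there was none.\<close>

lemma avoiding_trace:
  assumes F: "avoiding p V F" and X: "X \<subseteq> V"
  shows "avoiding p X ((\<lambda>C. C \<inter> X) ` F)"
proof -
  have sep: "separating ((\<lambda>C. C \<inter> X) ` F) x y = (\<lambda>C. C \<inter> X) ` separating F x y"
    if "x \<in> X" "y \<in> X" for x y
    by (rule separating_image) (use that in auto)
  show ?thesis
    unfolding avoiding_def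
  proof (intro conjI ballI impI)
    show "finite X"
      using avoiding_finite(1)[OF F] X by (rule rev_finite_subset)
    fix x y assume xy: "x \<in> X" "y \<in> X"
      and "p \<le> card (separating ((\<lambda>C. C \<inter> X) ` F) x y)"
    then have "p \<le> card (separating F x y)"
      using card_image_le[OF avoiding_finite(3)[OF F, of x y], of "\<lambda>C. C \<inter> X"] by (simp add: sep)
    then have "separating F y x = {}"
      using F X xy unfolding avoiding_def by blast
    then show "separating ((\<lambda>C. C \<inter> X) ` F) y x = {}"
      using xy by (simp add: sep)
  qed auto
qed

lemma inj_on_Diff_Pow: "F \<subseteq> Pow V \<Longrightarrow> inj_on (\<lambda>C. V - C) F"
  by (rule inj_onI) blast

lemma separating_complement:
  assumes "x \<in> V" "y \<in> V"
  shows "separating ((\<lambda>C. V - C) ` F) x y = (\<lambda>C. V - C) ` separating F y x"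
  using assms by (auto simp: separating_def)

text \<open>Complementation exchanges the two orders of a pair of rows, and the avoidance condition
  is invariant under this exchange.\<close>

lemma avoiding_complement:
  assumes "avoiding p V F"
  shows "avoiding p V ((\<lambda>C. V - C) ` F)"
proof -
  have "inj_on (\<lambda>C. V - C) (separating F x y)" for x y
    using assms by (intro inj_on_Diff_Pow) (auto simp: avoiding_def separating_def)
  note card = card_image[OF this]
  show ?thesis
    unfolding avoiding_def
  proof (intro conjI ballI impI)
    fix x y assume xy: "x \<in> V" "y \<in> V"
      and "p \<le> card (separating ((\<lambda>C. V - C) ` F) x y)"
    then show "separating ((\<lambda>C. V - C) ` F) y x = {}"
      using avoiding_card_less[OF assms xy(2,1)] xy
      by (cases "separating F x y = {}") (simp_all add: separating_complement card)
  qed (use avoiding_finite(1)[OF assms] in auto)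
qed

lemma degree_complement:
  assumes "F \<subseteq> Pow V" "finite F" "x \<in> V"
  shows "degree ((\<lambda>C. V - C) ` F) x + degree F x = card F"
proof -
  have "degree ((\<lambda>C. V - C) ` F) x = card ((\<lambda>C. V - C) ` {C \<in> F. x \<notin> C})"
    unfolding degree_def using assms(3) by (intro arg_cong[where f = card]) auto
  also have "\<dots> = card {C \<in> F. x \<notin> C}"
    using assms(1) by (intro card_image inj_on_Diff_Pow) auto
  finally have "degree ((\<lambda>C. V - C) ` F) x = card {C \<in> F. x \<notin> C}" .
  then show ?thesis
    using card_filter_add_card_filter_not[OF assms(2), of "\<lambda>C. x \<in> C"] by (simp add: degree_def)
qed

lemma card_le_cards_trace:
  assumes fin: "finite F" and sub: "F \<subseteq> Pow V" and V: "V = X \<union> Y"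
    and sep: "\<And>x y. x \<in> X \<Longrightarrow> y \<in> Y \<Longrightarrow> separating F x y = {}"
    and le: "card ((\<lambda>C. C \<inter> X) ` F) \<le> a" "card ((\<lambda>C. C \<inter> Y) ` F) \<le> b" "0 < b"
  shows "card F < a + b"
proof -
  let ?L = "{C \<in> F. C \<inter> X = {}}" and ?U = "{C \<in> F. C \<inter> X \<noteq> {}}"
  have U: "Y \<subseteq> C" if C: "C \<in> ?U" for C
  proof
    fix y assume "y \<in> Y"
    obtain x where "x \<in> C" "x \<in> X" using C by blast
    then show "y \<in> C"
      using sep[OF _ \<open>y \<in> Y\<close>] C unfolding separating_def by blast
  qed
  have eq: "card F = card ?L + card ?U"
    using card_filter_add_card_filter_not[OF fin, of "\<lambda>C. C \<inter> X = {}"] by simp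
  have "inj_on (\<lambda>C. C \<inter> Y) ?L"
    using sub V by (intro inj_onI) blast
  then have L: "card ?L \<le> card ((\<lambda>C. C \<inter> Y) ` F)"
    using fin by (intro card_inj_on_le) auto
  have "inj_on (\<lambda>C. C \<inter> X) ?U"
  proof (rule inj_onI)
    fix C D assume "C \<in> ?U" "D \<in> ?U" "C \<inter> X = D \<inter> X"
    moreover have "C \<subseteq> V" "D \<subseteq> V"
      using sub calculation by auto
    moreover have "Y \<subseteq> C" "Y \<subseteq> D"
      using U calculation by simp_all
    ultimately show "C = D"
      using V by blast
  qed
  then have U': "card ?U \<le> card ((\<lambda>C. C \<inter> X) ` F - {{}})"
    using fin by (intro card_inj_on_le) auto
  show ?thesis
  proof (cases "?L = {}")
    case True
    have "card ((\<lambda>C. C \<inter> X) ` F - {{}}) \<le> card ((\<lambda>C. C \<inter> X) ` F)"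
      using fin by (intro card_mono) auto
    then show ?thesis
      using eq U' le True by simp
  next
    case False
    then obtain C where "C \<in> F" "{} = C \<inter> X"
      by blast
    then have "{} \<in> (\<lambda>C. C \<inter> X) ` F"
      by (rule rev_image_eqI)
    then have "card ((\<lambda>C. C \<inter> X) ` F - {{}}) < card ((\<lambda>C. C \<inter> X) ` F)"
      using fin by (intro psubset_card_mono) auto
    then show ?thesis
      using eq U' L le by simp
  qed
qed

lemma sum_card_eq_sum_card_containing:
  assumes "finite V" "finite A" "A \<subseteq> Pow V"
  shows "(\<Sum>C\<in>A. card C) = (\<Sum>x\<in>V. card {C \<in> A. x \<in> C})"
proof -
  have "(\<Sum>C\<in>A. card C) = (\<Sum>C\<in>A. \<Sum>x\<in>{x \<in> V. x \<in> C}. 1)"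
    using assms by (intro sum.cong) (auto intro!: arg_cong[where f = card])
  also have "\<dots> = (\<Sum>x\<in>V. \<Sum>C\<in>{C \<in> A. x \<in> C}. 1)"
    by (rule sum.swap_restrict[OF assms(2,1)])
  finally show ?thesis by simp
qed

text \<open>Every member has size at least 2 except the singletons, and these inject into the
  union.\<close>

lemma double_card_le_sum_card:
  assumes "finite V" "A \<subseteq> Pow V" "{} \<notin> A"
  shows "2 * card A \<le> (\<Sum>C\<in>A. card C) + card (\<Union>A)"
proof -
  have fin: "finite A" "\<And>C. C \<in> A \<Longrightarrow> finite C" "finite (\<Union>A)"
    using assms by (auto intro: finite_subset[of _ "Pow V"] finite_subset[of _ V])
  let ?S = "{C \<in> A. card C = 1}"
  have "?S \<subseteq> (\<lambda>x. {x}) ` \<Union>A"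
    by (auto simp: card_1_singleton_iff)
  then have "card ?S \<le> card (\<Union>A)"
    using fin by (meson card_image_le card_mono finite_imageI order_trans)
  moreover have "2 * card A \<le> (\<Sum>C\<in>A. card C + (if card C = 1 then 1 else 0))"
  proof -
    have "2 \<le> card C + (if card C = 1 then 1 else 0)" if "C \<in> A" for C
    proof -
      have "card C \<noteq> 0" using that assms(3) fin by auto
      then show ?thesis by auto
    qed
    from sum_mono[OF this] show ?thesis by (simp add: mult.commute)
  qed
  moreover have "(\<Sum>C\<in>A. if card C = 1 then 1 else 0 :: nat) = card ?S"
    using fin by (simp add: sum.If_cases Int_def)
  ultimately show ?thesis
    by (simp add: sum.distrib)
qed

section \<open>The upper bound\<close>

text \<open>A nonempty set missing the row \<open>t\<close> of largest degree only contains rows \<open>x\<close> with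
  \<^term>\<open>separating F x t \<noteq> {}\<close>, so that \<open>t\<close> exceeds \<open>x\<close> by at most 4 in degree; the sum of the
  sizes of these sets is at most \<open>\<Sum> (5 - \<delta>)\<close> with \<open>\<delta>\<close> the excess, and all but the singletons
  have size at least 2.\<close>

lemma double_card_missing_le:
  assumes F: "avoiding 6 V F" and t: "t \<in> V" and max: "\<And>x. x \<in> V \<Longrightarrow> degree F x \<le> degree F t"
  shows "2 * card {C \<in> F. t \<notin> C}
    \<le> 2 + (\<Sum>x | x \<in> V - {t} \<and> degree F t \<le> degree F x + 4. 6 - (degree F t - degree F x))"
proof -
  let ?A = "{C \<in> F. t \<notin> C} - {{}}" and ?T = "{x \<in> V - {t}. degree F t \<le> degree F x + 4}"
  note fin = avoiding_finite[OF F]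
  have sub: "F \<subseteq> Pow V" using F by (simp add: avoiding_def)
  \<comment> \<open>As \<open>x\<close> is separated from \<open>t\<close>, avoidance allows at most
    5 sets separating \<open>t\<close> from \<open>x\<close>. By \<open>separating_degree\<close>
    this number is the excess of \<open>t\<close> over \<open>x\<close> plus
    \<open>card (separating F x t)\<close>, which is at least 1.\<close>
  have key: "degree F t \<le> degree F x + 4 \<and> card (separating F x t) \<le> 5 - (degree F t - degree F x)"
    if "x \<in> V" "separating F x t \<noteq> {}" for x
  proof -
    have "\<not> 6 \<le> card (separating F t x)"
      using avoiding_card_less[OF F t that] by simp
    moreover have "card (separating F x t) > 0"
      using that fin by (simp add: card_gt_0_iff)
    moreover note separating_degree[OF fin(2), of x t] max[OF that(1)]
    ultimately show ?thesis by simp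
  qed
  have le5: "card (separating F x t) \<le> 5 - (degree F t - degree F x)" if "x \<in> V" for x
    using key[OF that] by (cases "separating F x t = {}") auto
  have UT: "\<Union>?A \<subseteq> ?T"
  proof
    fix x assume "x \<in> \<Union>?A"
    then have "x \<in> V" "x \<noteq> t" "separating F x t \<noteq> {}"
      using sub by (auto simp: separating_def)
    with key show "x \<in> ?T" by simp
  qed
  have "(\<Sum>C\<in>?A. card C) = (\<Sum>x\<in>?T. card {C \<in> ?A. x \<in> C})"
    by (rule sum_card_eq_sum_card_containing) (use fin UT in auto)
  also have "\<dots> \<le> (\<Sum>x\<in>?T. 5 - (degree F t - degree F x))"
  proof (rule sum_mono)
    fix x assume "x \<in> ?T"
    moreover have "{C \<in> ?A. x \<in> C} = separating F x t"
      by (auto simp: separating_def)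
    ultimately show "card {C \<in> ?A. x \<in> C} \<le> 5 - (degree F t - degree F x)"
      using le5 by simp
  qed
  finally have "(\<Sum>C\<in>?A. card C) \<le> (\<Sum>x\<in>?T. 5 - (degree F t - degree F x))" .
  moreover have "card (\<Union>?A) \<le> card ?T"
    using UT fin by (intro card_mono) auto
  moreover have "2 * card ?A \<le> (\<Sum>C\<in>?A. card C) + card (\<Union>?A)"
    by (rule double_card_le_sum_card) (use fin sub in auto)
  \<comment> \<open>The 6 is the 5 from the sizes plus 1 for a possible singleton; the excess is at
    most 4 on \<open>?T\<close>, so no subtraction truncates.\<close>
  moreover have "(\<Sum>x\<in>?T. 5 - (degree F t - degree F x)) + card ?T
      = (\<Sum>x\<in>?T. 6 - (degree F t - degree F x))"
    unfolding card_eq_sum sum.distrib[symmetric] by (rule sum.cong) auto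
  moreover have "card {C \<in> F. t \<notin> C} \<le> Suc (card ?A)"
  proof -
    have "card {C \<in> F. t \<notin> C} \<le> card (insert {} ?A)"
      using fin by (intro card_mono) auto
    then show ?thesis
      using fin by (simp add: card_insert_if split: if_splits)
  qed
  ultimately show ?thesis by linarith
qed

text \<open>This is the floor of \<open>21 * m / 5\<close>, raised by 1 exactly at multiples of 5,
  so the induction proves the equality clause together with the bound.\<close>

definition column_bound :: "nat \<Rightarrow> nat" where
  "column_bound m = 4 * m + m div 5 + (if 5 dvd m then 1 else 0)"

text \<open>If 5 divides \<open>a\<close> or \<open>b\<close>, the quotients by 5 add up exactly and
  the corrections cost at most 1. The 1 on the right is paid for by the strict inequality in
  \<open>card_le_cards_trace\<close>.\<close>

lemma column_bound_add: "column_bound a + column_bound b \<le> column_bound (a + b) + 1"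
  unfolding column_bound_def by auto

text \<open>Counts triples of a row in \<open>C\<close>, a row outside \<open>C\<close>, and a
  member \<open>C\<close> other than the empty and the full set. These two exceptions add 2 at the
  end, giving at most \<open>4 * m + 1\<close> for \<open>m\<close> above 5 and 22 for
  \<open>m = 5\<close>.\<close>

lemma card_le_of_card_separating_le:
  assumes fin: "finite V" and sub: "F \<subseteq> Pow V" and m: "5 \<le> card V"
    and le: "\<And>x y. x \<in> V \<Longrightarrow> y \<in> V \<Longrightarrow> card (separating F x y) \<le> 5"
  shows "card F \<le> column_bound (card V)"
proof -
  define m where "m = card V"
  define M where "M = F - {{}, V}"
  define E where "E = {C \<in> M. card C = 1 \<or> card C = m - 1}"
  have finF: "finite F" using fin sub by (simp add: finite_subset)
  then have finM: "finite M" by (simp add: M_def)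
  have card_M: "0 < card C" "card C < m" "card (V - C) = m - card C" "C \<subseteq> V" if "C \<in> M" for C
  proof -
    have "C \<subset> V" "C \<noteq> {}" using that sub by (auto simp: M_def)
    moreover from this have "finite C" using fin by (auto intro: finite_subset)
    ultimately show "0 < card C" "card C < m" "card (V - C) = m - card C" "C \<subseteq> V"
      using fin by (auto simp: m_def card_gt_0_iff psubset_card_mono card_Diff_subset)
  qed
  have "(\<Sum>C\<in>M. card C * (m - card C)) = (\<Sum>C\<in>M. card {p \<in> V \<times> V. fst p \<in> C \<and> snd p \<notin> C})"
  proof (rule sum.cong)
    fix C assume C: "C \<in> M"
    then have "{p \<in> V \<times> V. fst p \<in> C \<and> snd p \<notin> C} = C \<times> (V - C)"
      using card_M(4) by auto
    then show "card C * (m - card C) = card {p \<in> V \<times> V. fst p \<in> C \<and> snd p \<notin> C}"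
      using card_M(3)[OF C] by (simp add: card_cartesian_product)
  qed simp
  also have "\<dots> = (\<Sum>C\<in>M. \<Sum>p\<in>{p \<in> V \<times> V. fst p \<in> C \<and> snd p \<notin> C}. 1)"
    by simp
  also have "\<dots> = (\<Sum>p\<in>V \<times> V. \<Sum>C\<in>{C \<in> M. fst p \<in> C \<and> snd p \<notin> C}. 1)"
    by (rule sum.swap_restrict) (use finM fin in auto)
  also have "\<dots> \<le> (\<Sum>p\<in>V \<times> V. if fst p = snd p then 0 else 5)"
  proof (rule sum_mono)
    fix p assume p: "p \<in> V \<times> V"
    have "card {C \<in> M. fst p \<in> C \<and> snd p \<notin> C} \<le> card (separating F (fst p) (snd p))"
      using finF by (intro card_mono) (auto simp: separating_def M_def)
    also have "\<dots> \<le> (if fst p = snd p then 0 else 5)"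
      using le[of "fst p" "snd p"] p by (auto simp: separating_def)
    finally show "(\<Sum>C\<in>{C \<in> M. fst p \<in> C \<and> snd p \<notin> C}. 1) \<le> (if fst p = snd p then 0 else 5 :: nat)"
      by simp
  qed
  also have "\<dots> = (\<Sum>x\<in>V. \<Sum>y\<in>V. if x = y then 0 else 5)"
    by (simp add: sum.cartesian_product split_def)
  also have "\<dots> = (\<Sum>x\<in>V. 5 * (m - 1))"
  proof (rule sum.cong)
    fix x assume "x \<in> V"
    then have "(\<Sum>y\<in>V. if x = y then 0 else 5 :: nat) = (\<Sum>y\<in>V - {x}. 5)"
      using fin by (intro sum.mono_neutral_cong_right) auto
    then show "(\<Sum>y\<in>V. if x = y then 0 else 5 :: nat) = 5 * (m - 1)"
      using \<open>x \<in> V\<close> fin by (simp add: m_def)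
  qed simp
  finally have upper: "(\<Sum>C\<in>M. card C * (m - card C)) \<le> m * (5 * (m - 1))"
    by (simp add: m_def)
  have "E \<subseteq> (\<lambda>x. {x}) ` V \<union> (\<lambda>x. V - {x}) ` V"
  proof
    fix C assume "C \<in> E"
    then have C: "C \<in> M" "card C = 1 \<or> card (V - C) = 1"
      using card_M[of C] by (auto simp: E_def)
    from C(2) show "C \<in> (\<lambda>x. {x}) ` V \<union> (\<lambda>x. V - {x}) ` V"
    proof
      assume "card C = 1"
      then show ?thesis using card_M(4)[OF C(1)] by (auto simp: card_1_singleton_iff)
    next
      assume "card (V - C) = 1"
      then obtain x where "V - C = {x}" by (auto simp: card_1_singleton_iff)
      moreover from this have "C = V - {x}" "x \<in> V" using card_M(4)[OF C(1)] by auto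
      ultimately show ?thesis by blast
    qed
  qed
  then have "card E \<le> card ((\<lambda>x. {x}) ` V \<union> (\<lambda>x. V - {x}) ` V)"
    using fin by (intro card_mono) auto
  also have "\<dots> \<le> 2 * m"
    using card_Un_le[of "(\<lambda>x. {x}) ` V" "(\<lambda>x. V - {x}) ` V"]
      card_image_le[OF fin, of "\<lambda>x. {x}"] card_image_le[OF fin, of "\<lambda>x. V - {x}"]
    by (simp add: m_def)
  finally have E: "card E \<le> 2 * m" .
  \<comment> \<open>The correction \<open>m - 3\<close> is the shortfall of \<open>m - 1\<close>
    against \<open>2 * (m - 2)\<close>.\<close>
  have "2 * (m - 2) \<le> card C * (m - card C) + (if C \<in> E then m - 3 else 0)" if "C \<in> M" for C
  proof (cases "C \<in> E")
    case True
    then have "card C * (m - card C) = m - 1"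
      using assms(3) by (auto simp: E_def m_def)
    then show ?thesis using True by simp
  next
    case False
    then have "2 \<le> card C" "card C + 2 \<le> m"
      using that card_M(1,2)[OF that] by (auto simp: E_def)
    \<comment> \<open>In these terms the product exceeds \<open>2 * (m - 2)\<close> by
      \<open>a * b\<close>.\<close>
    then obtain a b where ab: "card C = a + 2" "m = (a + 2) + (b + 2)"
      by (metis add.commute add.assoc le_Suc_ex)
    show ?thesis
      unfolding ab by (simp add: algebra_simps)
  qed
  then have "(\<Sum>C\<in>M. 2 * (m - 2)) \<le> (\<Sum>C\<in>M. card C * (m - card C) + (if C \<in> E then m - 3 else 0))"
    by (rule sum_mono)
  also have "\<dots> = (\<Sum>C\<in>M. card C * (m - card C)) + card E * (m - 3)"
  proof -
    have "M \<inter> {C. C \<in> E} = E" by (auto simp: E_def)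
    then show ?thesis using finM by (simp add: sum.distrib sum.If_cases)
  qed
  also have "\<dots> \<le> m * (5 * (m - 1)) + 2 * m * (m - 3)"
    using upper E by (intro add_mono mult_right_mono) auto
  finally have main: "card M * (2 * (m - 2)) \<le> m * (5 * (m - 1)) + 2 * m * (m - 3)"
    by simp
  \<comment> \<open>If \<open>card M\<close> were at least \<open>4 * m\<close>, cancelling
    \<open>m\<close> in \<open>main\<close> would give \<open>8 * (m - 2) \<le> 7 * m - 11\<close>,
    that is \<open>m \<le> 5\<close>.\<close>
  have "card M < 4 * m \<or> m = 5 \<and> card M \<le> 20"
  proof (cases "m = 5")
    case True
    then show ?thesis using main by simp
  next
    case False
    then have "6 \<le> m"
      using m by (simp add: m_def)
    then obtain k where k: "m = 6 + k"
      using le_Suc_ex by blast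
    have "card M < 4 * m"
    proof (rule ccontr)
      assume "\<not> card M < 4 * m"
      then have "4 * m * (2 * (m - 2)) \<le> card M * (2 * (m - 2))"
        by (intro mult_right_mono) auto
      also note main
      finally show False
        unfolding k by (simp add: algebra_simps)
    qed
    then show ?thesis ..
  qed
  moreover have "card F \<le> card M + 2"
  proof -
    have "card F \<le> card (insert {} (insert V M))"
      using finM by (intro card_mono) (auto simp: M_def)
    then show ?thesis
      using finM by (auto simp: card_insert_if split: if_splits)
  qed
  moreover have "1 \<le> m div 5"
    using assms(3) by (simp add: m_def)
  ultimately show ?thesis
    unfolding column_bound_def m_def[symmetric] by auto
qed

text \<open>The dual of \<open>double_card_missing_le\<close>: in the family of complements
  \<open>s\<close> has the largest degree, differences of degrees change sign, and the sets missing
  \<open>s\<close> come from those containing it.\<close>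

lemma double_card_containing_le:
  assumes F: "avoiding 6 V F" and s: "s \<in> V" and min: "\<And>x. x \<in> V \<Longrightarrow> degree F s \<le> degree F x"
  shows "2 * degree F s
    \<le> 2 + (\<Sum>x | x \<in> V - {s} \<and> degree F x \<le> degree F s + 4. 6 - (degree F x - degree F s))"
proof -
  let ?G = "(\<lambda>C. V - C) ` F"
  have sub: "F \<subseteq> Pow V" using F by (simp add: avoiding_def)
  have deg: "degree ?G x + degree F x = card F" if "x \<in> V" for x
    by (rule degree_complement[OF sub avoiding_finite(2)[OF F] that])
  have max: "degree ?G x \<le> degree ?G s" if "x \<in> V" for x
    using deg[OF that] deg[OF s] min[OF that] by linarith
  have "card {C \<in> ?G. s \<notin> C} + degree ?G s = card ?G"
    using card_filter_add_card_filter_not[of ?G "\<lambda>C. s \<in> C"] avoiding_finite(2)[OF F]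
    by (simp add: degree_def)
  then have degs: "degree F s = card {C \<in> ?G. s \<notin> C}"
    using deg[OF s] card_image[OF inj_on_Diff_Pow[OF sub]] by simp
  have "{x \<in> V - {s}. degree ?G s \<le> degree ?G x + 4}
      = {x \<in> V - {s}. degree F x \<le> degree F s + 4}"
    using deg s by (intro Collect_cong) (smt (verit, ccfv_threshold) add_le_cancel_right add.commute add.left_commute DiffD1)
  moreover have "6 - (degree ?G s - degree ?G x) = 6 - (degree F x - degree F s)" if "x \<in> V" for x
    using deg[OF that] deg[OF s] by linarith
  ultimately have "(\<Sum>x | x \<in> V - {s} \<and> degree ?G s \<le> degree ?G x + 4. 6 - (degree ?G s - degree ?G x))
      = (\<Sum>x | x \<in> V - {s} \<and> degree F x \<le> degree F s + 4. 6 - (degree F x - degree F s))"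
    by (intro sum.cong) auto
  then show ?thesis
    using double_card_missing_le[OF avoiding_complement[OF F] s max] degs by simp
qed

text \<open>\<open>card F\<close> is the number of members missing \<open>t\<close>, plus
  \<open>D\<close>, plus the degree of \<open>s\<close>. The outer terms are bounded by sums over
  \<open>T\<close> and \<open>B\<close>, the rows of degree close to that of \<open>t\<close> and
  \<open>s\<close>.\<close>

lemma card_le_of_spread:
  assumes F: "avoiding 6 V F" and s: "s \<in> V" and t: "t \<in> V"
    and min: "\<And>x. x \<in> V \<Longrightarrow> degree F s \<le> degree F x"
    and max: "\<And>x. x \<in> V \<Longrightarrow> degree F x \<le> degree F t"
    and spread: "degree F s + 5 \<le> degree F t" and m: "5 \<le> card V"
    and no_gap: "\<And>z. (\<exists>x\<in>V. degree F x \<le> z) \<Longrightarrow> (\<exists>x\<in>V. z + 5 \<le> degree F x) \<Longrightarrow>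
      \<exists>x\<in>V. z < degree F x \<and> degree F x < z + 5"
  shows "card F \<le> 4 * card V"
proof -
  define d where "d = degree F"
  define D where "D = d t - d s"
  define T where "T = {x \<in> V - {t}. d t \<le> d x + 4}"
  define B where "B = {x \<in> V - {s}. d x \<le> d s + 4}"
  have finV: "finite V" using F by (rule avoiding_finite)
  have fin: "finite T" "finite B" using finV by (simp_all add: T_def B_def)
  have d: "d s \<le> d x" "d x \<le> d t" if "x \<in> V" for x
    using min max that by (simp_all add: d_def)
  have spread': "d s + 5 \<le> d t" using spread by (simp add: d_def)
  have nst: "s \<noteq> t" "s \<notin> T" "t \<notin> B"
    using spread' by (auto simp: T_def B_def)
  have "card {C \<in> F. t \<notin> C} + d t = card F"
    using card_filter_add_card_filter_not[OF avoiding_finite(2)[OF F], of "\<lambda>C. t \<in> C"]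
    by (simp add: d_def degree_def)
  moreover have "2 * card {C \<in> F. t \<notin> C} \<le> 2 + (\<Sum>x\<in>T. 6 - (d t - d x))"
    using double_card_missing_le[OF F t max] by (simp add: T_def d_def)
  moreover have "2 * d s \<le> 2 + (\<Sum>x\<in>B. 6 - (d x - d s))"
    using double_card_containing_le[OF F s min] by (simp add: B_def d_def)
  ultimately have main: "2 * card F \<le> 4 + (\<Sum>x\<in>T. 6 - (d t - d x)) + (\<Sum>x\<in>B. 6 - (d x - d s)) + 2 * D"
    unfolding D_def using spread' by simp
  \<comment> \<open>The intervals of length 4 starting at the degrees cover the whole range: if
    \<open>s\<close> does not cover \<open>w\<close>, \<open>no_gap\<close> at \<open>w - 4\<close>
    yields a degree from \<open>w - 3\<close> to \<open>w\<close>.\<close>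
  have cover: "\<exists>x\<in>V. d x \<le> w \<and> w < d x + 4" if "d s \<le> w" "w < d t" for w
  proof (rule ccontr)
    assume none: "\<not> ?thesis"
    with s that(1) have "d s + 4 \<le> w"
      by (meson not_le_imp_less)
    then obtain z where z: "w = z + 4"
      by (metis add.commute add_leD2 le_Suc_ex)
    have "d s \<le> z" "z + 5 \<le> d t"
      using \<open>d s + 4 \<le> w\<close> that(2) z by auto
    then obtain x where "x \<in> V" "z < d x" "d x < z + 5"
      using no_gap[of z] s t by (auto simp: d_def)
    with none z show False by force
  qed
  show ?thesis
  proof (cases "D \<le> 8")
    case True
    \<comment> \<open>A row in both \<open>T\<close> and \<open>B\<close> contributes
      \<open>12 - D\<close>, a row in only one of them at most 6; so 7 is needed just for
      \<open>D = 5\<close>.\<close>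
    define c :: nat where "c = (if D = 5 then 7 else 6)"
    have TB: "T \<subseteq> V - {s, t}" "B \<subseteq> V - {s, t}"
      using nst by (auto simp: T_def B_def)
    have "(\<Sum>x\<in>T. 6 - (d t - d x)) = (\<Sum>x\<in>V - {s, t}. if x \<in> T then 6 - (d t - d x) else 0)"
      using TB finV by (intro sum.mono_neutral_cong_left) auto
    moreover have "(\<Sum>x\<in>B. 6 - (d x - d s)) = (\<Sum>x\<in>V - {s, t}. if x \<in> B then 6 - (d x - d s) else 0)"
      using TB finV by (intro sum.mono_neutral_cong_left) auto
    ultimately have "(\<Sum>x\<in>T. 6 - (d t - d x)) + (\<Sum>x\<in>B. 6 - (d x - d s))
        = (\<Sum>x\<in>V - {s, t}. (if x \<in> T then 6 - (d t - d x) else 0) + (if x \<in> B then 6 - (d x - d s) else 0))"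
      by (simp add: sum.distrib)
    also have "\<dots> \<le> (\<Sum>x\<in>V - {s, t}. c)"
    proof (rule sum_mono)
      fix x assume "x \<in> V - {s, t}"
      then have "d s \<le> d x" "d x \<le> d t" using d by auto
      then show "(if x \<in> T then 6 - (d t - d x) else 0) + (if x \<in> B then 6 - (d x - d s) else 0) \<le> c"
        using spread' by (auto simp: T_def B_def c_def D_def)
    qed
    also have "\<dots> = (card V - 2) * c"
      using s t nst finV by (simp add: card_Diff_subset numeral_2_eq_2)
    finally have "2 * card F \<le> 4 + (card V - 2) * c + 2 * D"
      using main by linarith
    then show ?thesis
      using m True by (cases "D = 5") (simp_all add: c_def)
  next
    case False
    \<comment> \<open>\<open>u\<close> and \<open>v\<close> are the inner ends of the degree ranges
      of \<open>T\<close> and \<open>B\<close>. The absence of gaps next to \<open>t\<close> and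
      \<open>s\<close> makes both sets nonempty.\<close>
    obtain u where u: "u \<in> T" "\<And>x. x \<in> T \<Longrightarrow> d u \<le> d x"
    proof -
      have "\<exists>x\<in>V. d x \<le> d t - 1 \<and> d t - 1 < d x + 4"
        using spread' by (intro cover) auto
      then have "T \<noteq> {}"
        using spread' by (auto simp: T_def)
      then show thesis
        using that arg_min_if_finite(1)[OF fin(1), of d] arg_min_least[OF fin(1), of _ d]
        by blast
    qed
    obtain v where v: "v \<in> B" "\<And>x. x \<in> B \<Longrightarrow> d x \<le> d v"
    proof -
      have "\<exists>x\<in>V. d s < d x \<and> d x < d s + 5"
        unfolding d_def using s t spread by (intro no_gap) auto
      then have "B \<noteq> {}"
        by (auto simp: B_def)
      then show thesis
        using that Max_in[of "d ` B"] Max_ge[of "d ` B"] fin by fastforce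
    qed
    have uv: "u \<in> V" "d t \<le> d u + 4" "v \<in> V" "d v \<le> d s + 4"
      using u v by (auto simp: T_def B_def)
    have "(\<Sum>x\<in>T. 6 - (d t - d x)) \<le> (6 - (d t - d u)) + (\<Sum>x\<in>T - {u}. 6)"
      by (subst sum.remove[OF fin(1) u(1)]) (intro add_left_mono sum_mono, simp)
    moreover have "(\<Sum>x\<in>T - {u}. 6 :: nat) = 6 * card (T - {u})" "Suc (card (T - {u})) = card T"
      using card_Suc_Diff1[OF fin(1) u(1)] by (simp_all only: sum_constant mult.commute of_nat_id)
    ultimately have sumT: "(\<Sum>x\<in>T. 6 - (d t - d x)) + (d t - d u) \<le> 6 * card T"
      using uv by linarith
    have "(\<Sum>x\<in>B. 6 - (d x - d s)) \<le> (6 - (d v - d s)) + (\<Sum>x\<in>B - {v}. 6)"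
      by (subst sum.remove[OF fin(2) v(1)]) (intro add_left_mono sum_mono, simp)
    moreover have "(\<Sum>x\<in>B - {v}. 6 :: nat) = 6 * card (B - {v})" "Suc (card (B - {v})) = card B"
      using card_Suc_Diff1[OF fin(2) v(1)] by (simp_all only: sum_constant mult.commute of_nat_id)
    ultimately have sumB: "(\<Sum>x\<in>B. 6 - (d x - d s)) + (d v - d s) \<le> 6 * card B"
      using uv by linarith
    define R where "R = V - (T \<union> B \<union> {s, t})"
    have "T \<inter> B = {}"
      using False by (auto simp: T_def B_def D_def)
    then have "card (T \<union> B \<union> {s, t}) = card T + card B + 2"
      using fin nst by (subst card_Un_disjoint) (auto simp: card_Un_disjoint T_def B_def)
    moreover have sub: "T \<union> B \<union> {s, t} \<subseteq> V"
      using s t by (auto simp: T_def B_def)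
    moreover have "card R = card V - card (T \<union> B \<union> {s, t})"
      unfolding R_def using finite_subset[OF sub finV] sub by (rule card_Diff_subset)
    ultimately have card_R: "card R + card T + card B + 2 = card V"
      using card_mono[OF finV sub] by linarith
    \<comment> \<open>Between \<open>d v\<close> and \<open>d u\<close>, a row covering
      \<open>w\<close> is neither \<open>t\<close> nor in \<open>T\<close>. If it is
      \<open>s\<close> or in \<open>B\<close>, its degree is at most \<open>d v\<close>, so all such
      rows together need only the one interval from \<open>d v\<close>.\<close>
    have "{d s..<d t} \<subseteq> {d s..<d v} \<union> {d u..<d t} \<union> {d v..<d v + 4} \<union> (\<Union>x\<in>R. {d x..<d x + 4})"
    proof
      fix w assume "w \<in> {d s..<d t}"
      then have w: "d s \<le> w" "w < d t" by auto
      show "w \<in> {d s..<d v} \<union> {d u..<d t} \<union> {d v..<d v + 4} \<union> (\<Union>x\<in>R. {d x..<d x + 4})"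
      proof (cases "d v \<le> w \<and> w < d u")
        case True
        obtain x where x: "x \<in> V" "d x \<le> w" "w < d x + 4" using cover[OF w] by blast
        have "x \<notin> T" "x \<noteq> t"
          using True x u(2)[of x] d(2)[OF uv(1)] by auto
        then show ?thesis
        proof (cases "x \<in> B \<union> {s}")
          case True
          then have "d x \<le> d v" using v(2) d(1)[OF uv(3)] by auto
          then show ?thesis using x \<open>d v \<le> w \<and> w < d u\<close> by auto
        next
          case False
          then have "x \<in> R" using x \<open>x \<notin> T\<close> \<open>x \<noteq> t\<close> by (auto simp: R_def)
          then show ?thesis using x by auto
        qed
      qed (use w in auto)
    qed
    then have "card {d s..<d t} \<le> card ({d s..<d v} \<union> {d u..<d t} \<union> {d v..<d v + 4} \<union> (\<Union>x\<in>R. {d x..<d x + 4}))"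
      using finV by (intro card_mono) (auto simp: R_def)
    also have "\<dots> \<le> card {d s..<d v} + card {d u..<d t} + card {d v..<d v + 4} + card (\<Union>x\<in>R. {d x..<d x + 4})"
      by (intro order_trans[OF card_Un_le] add_mono order_refl)
    also have "card (\<Union>x\<in>R. {d x..<d x + 4}) \<le> (\<Sum>x\<in>R. card {d x..<d x + 4})"
      using finV by (intro card_UN_le) (simp add: R_def)
    finally have "D \<le> (d v - d s) + (d t - d u) + 4 + 4 * card R"
      by (simp add: D_def mult.commute)
    \<comment> \<open>The linear estimate closes because \<open>d t - d u\<close> and
      \<open>d v - d s\<close> are at most 4 each: the resulting constant 20 is at most 16 plus
      twice \<open>card T + card B\<close>.\<close>
    moreover have "card T > 0" "card B > 0"
      using u v fin by (auto simp: card_gt_0_iff)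
    ultimately show ?thesis
      using main sumT sumB card_R uv by linarith
  qed
qed

theorem avoiding_card_le:
  assumes "avoiding 6 V F" "V \<noteq> {}"
  shows "card F \<le> column_bound (card V)"
  using assms
proof (induction "card V" arbitrary: V F rule: less_induct)
  case less
  note F = less.prems(1) and ne = less.prems(2)
  have finV: "finite V" and finF: "finite F" and sub: "F \<subseteq> Pow V"
    using avoiding_finite[OF F] F by (auto simp: avoiding_def)
  \<comment> \<open>In case \<open>split\<close> the degrees \<open>z + 1\<close> to
    \<open>z + 4\<close> are attained by no row, while rows exist on both sides.\<close>
  consider (small) "card V < 5"
    | (split) z x y where "x \<in> V" "degree F x \<le> z" "y \<in> V" "z + 5 \<le> degree F y"
        "\<And>x. x \<in> V \<Longrightarrow> degree F x \<le> z \<or> z + 5 \<le> degree F x"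
    | (no_gap) "5 \<le> card V" "\<And>z. (\<exists>x\<in>V. degree F x \<le> z) \<Longrightarrow> (\<exists>x\<in>V. z + 5 \<le> degree F x) \<Longrightarrow>
      \<exists>x\<in>V. z < degree F x \<and> degree F x < z + 5"
    by (meson not_le_imp_less)
  then show ?case
  proof cases
    case small
    have "card V \<noteq> 0" using ne finV by simp
    \<comment> \<open>All subsets may occur here; the estimate is sharp for 4 rows.\<close>
    then have "2 ^ card V \<le> 4 * card V"
      using small by (auto simp: less_Suc_eq numeral_eq_Suc)
    moreover have "card F \<le> 2 ^ card V"
      using card_mono[OF _ sub] finV by (simp add: card_Pow)
    ultimately show ?thesis by (simp add: column_bound_def)
  next
    case split
    let ?X = "{x \<in> V. degree F x \<le> z}" and ?Y = "{x \<in> V. z + 5 \<le> degree F x}"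
    have V: "V = ?X \<union> ?Y" using split(5) by blast
    have disj: "?X \<inter> ?Y = {}" by auto
    have card: "card ?X + card ?Y = card V"
      using V disj finV card_Un_disjoint[of ?X ?Y] by simp
    have ne': "?X \<noteq> {}" "?Y \<noteq> {}" using split(1-4) by blast+
    then have pos: "card ?X > 0" "card ?Y > 0" using finV by (auto simp: card_gt_0_iff)
    \<comment> \<open>A single set separating \<open>x\<close> from \<open>y\<close>, on top of a
      degree difference of at least 5, would force 6 sets separating \<open>y\<close> from
      \<open>x\<close>.\<close>
    have sep: "separating F x y = {}" if "x \<in> ?X" "y \<in> ?Y" for x y
    proof (rule ccontr)
      assume "separating F x y \<noteq> {}"
      then have "card (separating F y x) < 6" "card (separating F x y) > 0"
        using avoiding_card_less[OF F, of y x] avoiding_finite(3)[OF F] that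
        by (auto simp: card_gt_0_iff)
      then show False
        using separating_degree[OF finF, of x y] that by auto
    qed
    have "card F < column_bound (card ?X) + column_bound (card ?Y)"
    proof (rule card_le_cards_trace[OF finF sub V sep])
      show "card ((\<lambda>C. C \<inter> ?X) ` F) \<le> column_bound (card ?X)"
        using less.hyps[of ?X] avoiding_trace[OF F, of ?X] card pos ne' by auto
      show "card ((\<lambda>C. C \<inter> ?Y) ` F) \<le> column_bound (card ?Y)"
        using less.hyps[of ?Y] avoiding_trace[OF F, of ?Y] card pos ne' by auto
      show "0 < column_bound (card ?Y)" using pos by (simp add: column_bound_def)
    qed
    then show ?thesis
      using column_bound_add[of "card ?X" "card ?Y"] card by simp
  next
    case no_gap
    obtain s where s: "s \<in> V" "\<And>x. x \<in> V \<Longrightarrow> degree F s \<le> degree F x"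
      using that arg_min_if_finite(1)[OF finV ne, of "degree F"] arg_min_least[OF finV _, of _ "degree F"]
      by blast
    obtain t where t: "t \<in> V" "\<And>x. x \<in> V \<Longrightarrow> degree F x \<le> degree F t"
      using Max_in[of "degree F ` V"] Max_ge[of "degree F ` V"] finV ne by fastforce
    show ?thesis
    proof (cases "degree F s + 5 \<le> degree F t")
      case True
      have "card F \<le> 4 * card V"
        by (rule card_le_of_spread[OF F s(1) t(1) s(2) t(2) True no_gap])
      then show ?thesis by (simp add: column_bound_def)
    next
      case False
      show ?thesis
      proof (rule card_le_of_card_separating_le[OF finV sub no_gap(1)])
        fix x y assume xy: "x \<in> V" "y \<in> V"
        show "card (separating F x y) \<le> 5"
        \<comment> \<open>With no separation in the other direction the count is a difference of
          degrees, here at most 4; otherwise avoidance gives at most 5.\<close>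
        proof (cases "separating F y x = {}")
          case True
          then show ?thesis
            using separating_degree[OF finF, of x y] s(2)[OF xy(2)] t(2)[OF xy(1)] False by simp
        next
          case False
          then show ?thesis
            using avoiding_card_less[OF F xy] by simp
        qed
      qed
    qed
  qed
qed

section \<open>The construction\<close>

text \<open>Members of \<open>F\<close> are filled up with the whole upper block, members of
  \<open>G\<close> are shifted into it, so no set separates a lower row from an upper one. The only
  common member is the upper block, from \<open>{}\<close> in \<open>F\<close> and the full set in
  \<open>G\<close>; hence the \<open>Suc\<close>. Keeping the empty and the full set lets the
  construction be iterated.\<close>

lemma avoiding_ordinal_sum:
  fixes F G :: "nat set set"
  assumes F: "avoiding p {..<m} F" "{} \<in> F" "{..<m} \<in> F"
    and G: "avoiding p {..<k} G" "{} \<in> G" "{..<k} \<in> G" and p: "0 < p"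
  shows "\<exists>H. avoiding p {..<m + k} H \<and> {} \<in> H \<and> {..<m + k} \<in> H \<and> Suc (card H) = card F + card G"
proof -
  let ?f = "\<lambda>C. C \<union> {m..<m + k}" and ?g = "\<lambda>D. (+) m ` D"
  let ?H = "?f ` F \<union> ?g ` G"
  have subF: "C \<subseteq> {..<m}" if "C \<in> F" for C using F(1) that unfolding avoiding_def by blast
  have subG: "D \<subseteq> {..<k}" if "D \<in> G" for D using G(1) that unfolding avoiding_def by blast
  have block: "{m..<m + k} = ?g {..<k}"
    unfolding lessThan_atLeast0 image_add_atLeastLessThan by (simp add: add.commute)
  have H: "separating ?H x y = separating (?f ` F) x y \<union> separating (?g ` G) x y" for x y
    unfolding separating_def by blast
  have low: "x \<notin> ?g D" if "x < m" for x D
    using that by auto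
  have high: "m + x \<in> ?f C" if "x < k" for x C
    using that by simp
  have sep_F: "separating ?H x y = ?f ` separating F x y" if "x < m" "y < m" for x y
  proof -
    have "separating (?f ` F) x y = ?f ` separating F x y"
      by (rule separating_image) (use that in simp_all)
    moreover have "separating (?g ` G) x y = {}"
      using low[OF that(1)] unfolding separating_def by blast
    ultimately show ?thesis by (simp add: H)
  qed
  have sep_G: "separating ?H (m + x) (m + y) = ?g ` separating G x y" if "x < k" "y < k" for x y
  proof -
    have "separating (?g ` G) (m + x) (m + y) = ?g ` separating G x y"
      by (rule separating_image) auto
    moreover have "separating (?f ` F) (m + x) (m + y) = {}"
      using high[OF that(2)] unfolding separating_def by blast
    ultimately show ?thesis by (simp add: H)
  qed
  have sep_F_G: "separating ?H x (m + y) = {}" if "x < m" "y < k" for x y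
    using low[OF that(1)] high[OF that(2)] unfolding separating_def by blast
  have "avoiding p {..<m + k} ?H"
    unfolding avoiding_def
  proof (intro conjI ballI impI)
    show "?H \<subseteq> Pow {..<m + k}"
      using subF subG by fastforce
    fix x y assume xy: "x \<in> {..<m + k}" "y \<in> {..<m + k}" and le: "p \<le> card (separating ?H x y)"
    consider "x < m" "y < m" | "x < m" "\<not> y < m" | "\<not> x < m" "y < m" | "\<not> x < m" "\<not> y < m" by blast
    then show "separating ?H y x = {}"
    proof cases
      case 1
      then have "p \<le> card (separating F x y)"
        using le card_image_le[OF avoiding_finite(3)[OF F(1), of x y], of ?f] by (simp add: sep_F)
      then show ?thesis
        using avoiding_card_less[OF F(1), of x y] 1 by (auto simp: sep_F)
    next
      case 2
      then have "separating ?H x y = {}"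
        using sep_F_G[of x "y - m"] xy by simp
      then show ?thesis using le p by simp
    next
      case 3
      then show ?thesis using sep_F_G[of y "x - m"] xy by simp
    next
      case 4
      then obtain a b where ab: "x = m + a" "y = m + b" by (metis le_Suc_ex not_less)
      then have lt: "a < k" "b < k" using xy by auto
      then have "p \<le> card (separating G a b)"
        using le card_image_le[OF avoiding_finite(3)[OF G(1), of a b], of ?g] by (simp add: sep_G ab)
      then show ?thesis
        using avoiding_card_less[OF G(1), of a b] lt by (auto simp: sep_G ab)
    qed
  qed simp
  moreover have "{} \<in> ?H" using G(2) by blast
  moreover have "{..<m + k} \<in> ?H"
    using F(3) by (intro UnI1 image_eqI[of _ _ "{..<m}"]) auto
  moreover have "Suc (card ?H) = card F + card G"
  proof -
    have f: "inj_on ?f F"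
      by (rule inj_on_inverseI[of _ "\<lambda>E. E \<inter> {..<m}"]) (use subF in fastforce)
    have g: "inj_on ?g G"
      by (rule inj_onI) (simp add: inj_image_eq_iff)
    have "?f ` F \<inter> ?g ` G = {{m..<m + k}}"
    proof
      show "?f ` F \<inter> ?g ` G \<subseteq> {{m..<m + k}}"
      proof
        fix E assume "E \<in> ?f ` F \<inter> ?g ` G"
        then obtain C D where E: "C \<in> F" "E = ?f C" "D \<in> G" "E = ?g D" by blast
        then have "C \<subseteq> ?g D" "C \<subseteq> {..<m}" using subF by blast+
        then have "C = {}" by (auto simp: subset_iff)
        then show "E \<in> {{m..<m + k}}" using E by simp
      qed
      have "?f {} \<in> ?f ` F" "?g {..<k} \<in> ?g ` G" using F(2) G(3) by blast+
      then show "{{m..<m + k}} \<subseteq> ?f ` F \<inter> ?g ` G"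
        using block by simp
    qed
    then show ?thesis
      using card_Un_Int[of "?f ` F" "?g ` G"] avoiding_finite(2)[OF F(1)] avoiding_finite(2)[OF G(1)]
      by (simp add: card_image[OF f] card_image[OF g])
  qed
  ultimately show ?thesis by blast
qed

text \<open>Reduces avoidance to a finite check on lists, in the stronger form that no ordered pair
  is separated \<open>p\<close> times. Strict sorting makes \<open>set\<close> injective, so
  distinct lists give distinct sets.\<close>

lemma avoiding_set_lists:
  fixes ls :: "nat list list"
  assumes "distinct ls" and sorted: "\<forall>l\<in>set ls. sorted_wrt (<) l \<and> set l \<subseteq> {..<m}"
    and le: "\<forall>x<m. \<forall>y<m. length (filter (\<lambda>l. x \<in> set l \<and> y \<notin> set l) ls) < p"
  shows "avoiding p {..<m} (set ` set ls)" "card (set ` set ls) = length ls"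
proof -
  have "card (separating (set ` set ls) x y) < p" if "x < m" "y < m" for x y
  proof -
    have "separating (set ` set ls) x y = set ` set (filter (\<lambda>l. x \<in> set l \<and> y \<notin> set l) ls)"
      by (auto simp: separating_def)
    then have "card (separating (set ` set ls) x y) \<le> length (filter (\<lambda>l. x \<in> set l \<and> y \<notin> set l) ls)"
      by (metis card_image_le card_length finite_set order_trans)
    with le that show ?thesis by (meson order_le_less_trans)
  qed
  moreover have "set ` set ls \<subseteq> Pow {..<m}" using sorted by blast
  ultimately show "avoiding p {..<m} (set ` set ls)"
    unfolding avoiding_def by (auto simp: not_le[symmetric])
  have "inj_on set (set ls)"
    using sorted by (intro inj_onI) (metis strict_sorted_equal)
  then show "card (set ` set ls) = length ls"
    using distinct_card[OF assms(1)] by (simp add: card_image)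
qed

text \<open>The sets of size 2 are the edges of a 5-cycle, those of size 3 the complements of the edges
  of the complementary 5-cycle; every ordered pair of points is separated by exactly 5 sets.\<close>

definition block5 :: "nat list list" where
  "block5 = [[], [0], [1], [2], [3], [4], [0,1], [1,2], [2,3], [3,4], [0,4],
     [0,1,3], [0,2,3], [0,2,4], [1,2,4], [1,3,4],
     [0,1,2,3], [0,1,2,4], [0,1,3,4], [0,2,3,4], [1,2,3,4], [0,1,2,3,4]]"

text \<open>All sets of size 0, 1, 5 and 6, and 11 sets of size 2 to 4 found by computer search.\<close>

definition block6 :: "nat list list" where
  "block6 = [[], [0], [1], [2], [3], [4], [5], [0,3], [0,4], [1,2], [1,5], [2,4], [3,5],
     [0,2,5], [1,3,4], [0,1,2,3], [0,1,4,5], [2,3,4,5],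
     [0,1,2,3,4], [0,1,2,3,5], [0,1,2,4,5], [0,1,3,4,5], [0,2,3,4,5], [1,2,3,4,5], [0,1,2,3,4,5]]"

lemma block5:
  "avoiding 6 {..<5} (set ` set block5)" "card (set ` set block5) = 22"
  "{} \<in> set ` set block5" "{..<5} \<in> set ` set block5"
proof -
  have d: "distinct block5" and s: "\<forall>l\<in>set block5. sorted_wrt (<) l \<and> (\<forall>x\<in>set l. x < 5)"
    and f: "\<forall>x\<in>set [0..<5]. \<forall>y\<in>set [0..<5]. length (filter (\<lambda>l. x \<in> set l \<and> y \<notin> set l) block5) < 6"
    by code_simp+
  note * = avoiding_set_lists[of block5 5 6, OF d]
  show "avoiding 6 {..<5} (set ` set block5)"
    by (rule *(1)) (use s f in auto)
  have "card (set ` set block5) = length block5"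
    by (rule *(2)) (use s f in auto)
  then show "card (set ` set block5) = 22"
    by (simp add: block5_def)
  show "{} \<in> set ` set block5"
    by (simp add: block5_def)
  have "[0..<5] \<in> set block5"
    by code_simp
  then show "{..<5} \<in> set ` set block5"
    by (rule image_eqI[rotated]) (simp add: lessThan_atLeast0)
qed

lemma block6:
  "avoiding 6 {..<6} (set ` set block6)" "card (set ` set block6) = 25"
  "{} \<in> set ` set block6" "{..<6} \<in> set ` set block6"
proof -
  have d: "distinct block6" and s: "\<forall>l\<in>set block6. sorted_wrt (<) l \<and> (\<forall>x\<in>set l. x < 6)"
    and f: "\<forall>x\<in>set [0..<6]. \<forall>y\<in>set [0..<6]. length (filter (\<lambda>l. x \<in> set l \<and> y \<notin> set l) block6) < 6"
    by code_simp+
  note * = avoiding_set_lists[of block6 6 6, OF d]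
  show "avoiding 6 {..<6} (set ` set block6)"
    by (rule *(1)) (use s f in auto)
  have "card (set ` set block6) = length block6"
    by (rule *(2)) (use s f in auto)
  then show "card (set ` set block6) = 25"
    by (simp add: block6_def)
  show "{} \<in> set ` set block6"
    by (simp add: block6_def)
  have "[0..<6] \<in> set block6"
    by code_simp
  then show "{..<6} \<in> set ` set block6"
    by (rule image_eqI[rotated]) (simp add: lessThan_atLeast0)
qed

text \<open>One copy of \<open>block6\<close> and \<open>k\<close> copies of \<open>block5\<close>;
  each of the latter adds 22 sets, one of them shared.\<close>

lemma exists_avoiding_card:
  "\<exists>F. avoiding 6 {..<5 * k + 6} F \<and> {} \<in> F \<and> {..<5 * k + 6} \<in> F \<and> card F = 21 * k + 25"
proof (induction k)
  case 0
  then show ?case using block6 by (intro exI[of _ "set ` set block6"]) simp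
next
  case (Suc k)
  then obtain F where F: "avoiding 6 {..<5 * k + 6} F" "{} \<in> F" "{..<5 * k + 6} \<in> F" "card F = 21 * k + 25"
    by blast
  from avoiding_ordinal_sum[OF F(1-3) block5(1,3,4)] obtain H where
    "avoiding 6 {..<5 * k + 6 + 5} H" "{} \<in> H" "{..<5 * k + 6 + 5} \<in> H" "Suc (card H) = card F + 22"
    by (auto simp: block5(2))
  moreover have "5 * k + 6 + 5 = 5 * Suc k + 6" by simp
  ultimately show ?case
    using F(4) by (intro exI[of _ H]) (simp only: , simp)
qed

section \<open>Matrices and families of sets\<close>

lemma bij_betw_pick:
  assumes "finite S"
  shows "bij_betw (pick S) {..<card S} S"
proof -
  have "inj_on (pick S) {..<card S}"
    by (rule linorder_inj_onI) (use pick_mono_le in force)+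
  moreover have "pick S ` {..<card S} \<subseteq> S"
    using pick_in_set_le by auto
  ultimately show ?thesis
    using assms by (simp add: bij_betw_def card_image card_subset_eq)
qed

text \<open>The first \<open>p\<close> columns of \<open>F0p10 p\<close> coincide, so up to
  permutation only the numbers of columns of both kinds in two rows matter.\<close>

lemma configuration_in_F0p10_iff:
  assumes A: "elements_mat A \<subseteq> {0, 1 :: int}"
  shows "configuration_in (F0p10 p) A \<longleftrightarrow>
    (\<exists>x<dim_row A. \<exists>y<dim_row A. p \<le> card {j. j < dim_col A \<and> A $$ (x, j) = 1 \<and> A $$ (y, j) = 0} \<and>
      (\<exists>j<dim_col A. A $$ (x, j) = 0 \<and> A $$ (y, j) = 1))"
proof
  let ?P = "\<lambda>x y. {j. j < dim_col A \<and> A $$ (x, j) = 1 \<and> A $$ (y, j) = 0}"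
  let ?F = "F0p10 p"
  have dimF: "dim_row ?F = 2" "dim_col ?F = Suc p" by (simp_all add: F0p10_def)
  {
    assume "configuration_in ?F A"
    then obtain I J q r where I: "I \<subseteq> {..<dim_row A}" and J: "J \<subseteq> {..<dim_col A}"
      and q: "q permutes {..<2}" and r: "r permutes {..<Suc p}"
      and eq: "submatrix A I J = mat 2 (Suc p) (\<lambda>(i, j). ?F $$ (q i, r j))"
      by (auto simp: configuration_in_def row_col_permutation_def dimF)
    have "{i. i < dim_row A \<and> i \<in> I} = I" "{j. j < dim_col A \<and> j \<in> J} = J"
      using I J by auto
    then have sub: "submatrix A I J = mat (card I) (card J) (\<lambda>(i, j). A $$ (pick I i, pick J j))"
      by (simp add: submatrix_def)
    have card: "card I = 2" "card J = Suc p"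
      using arg_cong[OF eq, of dim_row] arg_cong[OF eq, of dim_col] by (simp_all add: sub)
    \<comment> \<open>The inverse permutations locate each row and column of \<open>F0p10 p\<close>
      inside the submatrix.\<close>
    let ?a = "inv_into UNIV q" and ?b = "inv_into UNIV r"
    have a: "?a i < 2" "q (?a i) = i" if "i < 2" for i
      using permutes_in_image[OF permutes_inv[OF q], of i] permutes_inverses(1)[OF q] that by auto
    have b: "?b j < Suc p" "r (?b j) = j" if "j < Suc p" for j
      using permutes_in_image[OF permutes_inv[OF r], of j] permutes_inverses(1)[OF r] that by auto
    have entry: "A $$ (pick I (?a i), pick J (?b j)) = ?F $$ (i, j)" if "i < 2" "j < Suc p" for i j
      using arg_cong[OF eq, of "\<lambda>M. M $$ (?a i, ?b j)"] a[OF that(1)] b[OF that(2)] by (simp add: sub card)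
    have pI: "pick I (?a i) < dim_row A" if "i < 2" for i
      using pick_in_set_le[of "?a i" I] a[OF that] I card by auto
    have pJ: "pick J (?b j) < dim_col A" if "j < Suc p" for j
      using pick_in_set_le[of "?b j" J] b[OF that] J card by auto
    have "inj_on (\<lambda>j. pick J (?b j)) {..<p}"
    proof (rule inj_onI)
      fix j k assume "j \<in> {..<p}" "k \<in> {..<p}" "pick J (?b j) = pick J (?b k)"
      moreover have "inj_on (pick J) {..<Suc p}"
        using bij_betw_pick[of J] finite_subset[OF J] card by (simp add: bij_betw_def)
      ultimately have "?b j = ?b k"
        using b(1)[of j] b(1)[of k] by (auto dest: inj_onD)
      then show "j = k"
        using permutes_inverses(1)[OF r] by metis
    qed
    moreover have "(\<lambda>j. pick J (?b j)) ` {..<p} \<subseteq> ?P (pick I (?a 0)) (pick I (?a 1))"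
      using entry pJ by (auto simp: F0p10_def)
    ultimately have "p \<le> card (?P (pick I (?a 0)) (pick I (?a 1)))"
      using card_inj_on_le[of _ "{..<p}"] by fastforce
    moreover have "A $$ (pick I (?a 0), pick J (?b p)) = 0" "A $$ (pick I (?a 1), pick J (?b p)) = 1"
      using entry[of 0 p] entry[of 1 p] by (simp_all add: F0p10_def)
    ultimately show "\<exists>x<dim_row A. \<exists>y<dim_row A. p \<le> card (?P x y) \<and>
        (\<exists>j<dim_col A. A $$ (x, j) = 0 \<and> A $$ (y, j) = 1)"
      using pI[of 0] pI[of 1] pJ[of p] by auto
  next
    assume "\<exists>x<dim_row A. \<exists>y<dim_row A. p \<le> card (?P x y) \<and>
        (\<exists>j<dim_col A. A $$ (x, j) = 0 \<and> A $$ (y, j) = 1)"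
    then obtain x y j where x: "x < dim_row A" and y: "y < dim_row A" and p: "p \<le> card (?P x y)"
      and j: "j < dim_col A" "A $$ (x, j) = 0" "A $$ (y, j) = 1" by blast
    obtain S where S: "S \<subseteq> ?P x y" "card S = p" "finite S"
      using obtain_subset_with_card_n[OF p] by blast
    define I where "I = {x, y}"
    define J where "J = insert j S"
    have "x \<noteq> y" "j \<notin> S" using j S(1) by auto
    then have card: "card I = 2" "card J = Suc p"
      using S by (simp_all add: I_def J_def)
    have IJ: "I \<subseteq> {..<dim_row A}" "J \<subseteq> {..<dim_col A}"
      using x y j S by (auto simp: I_def J_def)
    have bI: "bij_betw (pick I) {..<2} I" and bJ: "bij_betw (pick J) {..<Suc p} J"
      using bij_betw_pick[of I] bij_betw_pick[of J] S(3) card by (simp_all add: I_def J_def)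
    have "x \<in> pick I ` {..<2}" "j \<in> pick J ` {..<Suc p}"
      unfolding bij_betw_imp_surj_on[OF bI] bij_betw_imp_surj_on[OF bJ] by (simp_all add: I_def J_def)
    then obtain a b where a: "a < 2" "pick I a = x" and b: "b < Suc p" "pick J b = j"
      by blast
    \<comment> \<open>\<open>pick\<close> lists rows and columns in increasing order. One
      transposition matching \<open>x\<close> with row 0 and one matching \<open>j\<close> with the
      last column suffice, since the other \<open>p\<close> columns are interchangeable.\<close>
    let ?q = "transpose a 0" and ?r = "transpose b p"
    have perm: "?q permutes {..<2}" "?r permutes {..<Suc p}"
      using a b by (auto intro: permutes_swap_id)
    have row: "pick I i = (if ?q i = 0 then x else y)" if "i < 2" for i
    proof (cases "i = a")
      case False
      then have "pick I i \<noteq> x"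
        using inj_onD[OF bij_betw_imp_inj_on[OF bI], of i a] a that by auto
      moreover have "pick I i \<in> I"
        using bij_betw_apply[OF bI] that by simp
      moreover have "?q i \<noteq> 0"
        using False by (auto simp: transpose_def)
      ultimately show ?thesis by (auto simp: I_def)
    qed (use a in simp)
    have col: "if ?r k < p then pick J k \<in> S else pick J k = j" if "k < Suc p" for k
    proof (cases "k = b")
      case False
      then have "pick J k \<noteq> j"
        using inj_onD[OF bij_betw_imp_inj_on[OF bJ], of k b] b that by auto
      moreover have "pick J k \<in> J"
        using bij_betw_apply[OF bJ] that by simp
      moreover have "?r k < p"
        using False that b by (auto simp: transpose_def)
      ultimately show ?thesis by (auto simp: J_def)
    qed (use b in simp)
    have "{i. i < dim_row A \<and> i \<in> I} = I" "{j. j < dim_col A \<and> j \<in> J} = J"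
      using IJ by auto
    then have "submatrix A I J = mat 2 (Suc p) (\<lambda>(i, j). A $$ (pick I i, pick J j))"
      by (simp add: submatrix_def card)
    also have "\<dots> = mat 2 (Suc p) (\<lambda>(i, j). ?F $$ (?q i, ?r j))"
    proof (rule cong_mat)
      fix i k :: nat assume ik: "i < 2" "k < Suc p"
      have "?q i < 2" "?r k < Suc p"
        using permutes_in_image[OF perm(1), of i] permutes_in_image[OF perm(2), of k] ik by auto
      then have "?F $$ (?q i, ?r k) = (if ?r k < p then if ?q i = 0 then 1 else 0 else if ?q i = 0 then 0 else 1)"
        by (simp add: F0p10_def)
      also have "\<dots> = A $$ (pick I i, pick J k)"
        using row[OF ik(1)] col[OF ik(2)] S(1) j by (auto split: if_splits)
      finally show "(case (i, k) of (i, j) \<Rightarrow> A $$ (pick I i, pick J j)) = (case (i, k) of (i, j) \<Rightarrow> ?F $$ (?q i, ?r j))"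
        by simp
    qed simp_all
    finally show "configuration_in ?F A"
      unfolding configuration_in_def row_col_permutation_def dimF
      using IJ perm by blast
  }
qed

definition column_sets :: "int mat \<Rightarrow> nat set set" where
  "column_sets A = (\<lambda>j. {i. i < dim_row A \<and> A $$ (i, j) = 1}) ` {..<dim_col A}"

lemma simple_matrix_entry:
  assumes "simple_matrix A" "i < dim_row A" "j < dim_col A"
  shows "A $$ (i, j) = 0 \<or> A $$ (i, j) = 1"
proof -
  have "A $$ (i, j) \<in> elements_mat A"
    using elements_matI[OF carrier_matI[OF refl refl] assms(2,3) refl] .
  then show ?thesis
    using assms(1) by (auto simp: simple_matrix_def)
qed

lemma inj_on_column_set:
  assumes A: "simple_matrix A"
  shows "inj_on (\<lambda>j. {i. i < dim_row A \<and> A $$ (i, j) = 1}) {..<dim_col A}"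
proof (rule inj_onI)
  fix j k assume jk: "j \<in> {..<dim_col A}" "k \<in> {..<dim_col A}"
    and eq: "{i. i < dim_row A \<and> A $$ (i, j) = 1} = {i. i < dim_row A \<and> A $$ (i, k) = 1}"
  have "col A j = col A k"
  proof (rule eq_vecI)
    fix i assume "i < dim_vec (col A k)"
    then have i: "i < dim_row A" by simp
    have "A $$ (i, j) = 1 \<longleftrightarrow> A $$ (i, k) = 1"
      using eq i by blast
    then show "col A j $ i = col A k $ i"
      using simple_matrix_entry[OF A i, of j] simple_matrix_entry[OF A i, of k] jk i by auto
  qed simp
  then have "cols A ! j = cols A ! k"
    using jk by simp
  moreover have "distinct (cols A)"
    using A by (simp add: simple_matrix_def)
  ultimately show "j = k"
    using nth_eq_iff_index_eq[of "cols A" j k] jk by auto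
qed

lemma card_column_sets: "simple_matrix A \<Longrightarrow> card (column_sets A) = dim_col A"
  by (simp add: column_sets_def card_image inj_on_column_set)

text \<open>Distinct columns give distinct sets, so counts of column indices and of members agree in
  \<open>configuration_in_F0p10_iff\<close>.\<close>

lemma Avoid_iff_avoiding:
  assumes A: "simple_matrix A"
  shows "A \<in> Avoid m (F0p10 p) \<longleftrightarrow> dim_row A = m \<and> avoiding p {..<m} (column_sets A)"
proof -
  let ?c = "\<lambda>j. {i. i < dim_row A \<and> A $$ (i, j) = 1}"
  have el: "elements_mat A \<subseteq> {0, 1}" using A by (simp add: simple_matrix_def)
  have sep: "separating (column_sets A) x y = ?c ` {j. j < dim_col A \<and> A $$ (x, j) = 1 \<and> A $$ (y, j) = 0}"
    if xy: "x < dim_row A" "y < dim_row A" for x y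
  proof -
    have "separating (column_sets A) x y = ?c ` {j \<in> {..<dim_col A}. A $$ (x, j) = 1 \<and> A $$ (y, j) \<noteq> 1}"
      using xy by (auto simp: separating_def column_sets_def)
    also have "{j \<in> {..<dim_col A}. A $$ (x, j) = 1 \<and> A $$ (y, j) \<noteq> 1}
        = {j. j < dim_col A \<and> A $$ (x, j) = 1 \<and> A $$ (y, j) = 0}"
      using simple_matrix_entry[OF A xy(2)] by auto
    finally show ?thesis .
  qed
  have card: "card (separating (column_sets A) x y) = card {j. j < dim_col A \<and> A $$ (x, j) = 1 \<and> A $$ (y, j) = 0}"
    if "x < dim_row A" "y < dim_row A" for x y
    unfolding sep[OF that] by (rule card_image) (rule inj_on_subset[OF inj_on_column_set[OF A]], auto)
  have "separating (column_sets A) y x \<noteq> {} \<longleftrightarrow> (\<exists>j<dim_col A. A $$ (x, j) = 0 \<and> A $$ (y, j) = 1)"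
    if "x < dim_row A" "y < dim_row A" for x y
    unfolding sep[OF that(2,1)] by blast
  then have "configuration_in (F0p10 p) A \<longleftrightarrow> (\<exists>x<dim_row A. \<exists>y<dim_row A.
      p \<le> card (separating (column_sets A) x y) \<and> separating (column_sets A) y x \<noteq> {})"
    unfolding configuration_in_F0p10_iff[OF el] by (intro ex_cong conj_cong refl) (simp_all add: card)
  moreover have "column_sets A \<subseteq> Pow {..<dim_row A}"
    by (auto simp: column_sets_def)
  ultimately have "configuration_in (F0p10 p) A \<longleftrightarrow> \<not> avoiding p {..<dim_row A} (column_sets A)"
    unfolding avoiding_def using finite_lessThan[of "dim_row A"] by blast
  then show ?thesis
    using A by (auto simp: Avoid_def)
qed

lemma exists_simple_matrix:
  assumes "F \<subseteq> Pow {..<m}"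
  shows "\<exists>A. simple_matrix A \<and> dim_row A = m \<and> column_sets A = F"
proof -
  have "finite F" using assms by (simp add: finite_subset)
  then obtain Cs where Cs: "set Cs = F" "distinct Cs"
    using finite_distinct_list by blast
  define A :: "int mat" where "A = mat m (length Cs) (\<lambda>(i, j). if i \<in> Cs ! j then 1 else 0)"
  have sub: "Cs ! j \<subseteq> {..<m}" if "j < length Cs" for j
    using assms Cs(1) nth_mem[OF that] by blast
  have "distinct (cols A)"
    unfolding distinct_conv_nth
  proof (intro allI impI)
    fix j k assume jk: "j < length (cols A)" "k < length (cols A)" "j \<noteq> k"
    then have lt: "j < length Cs" "k < length Cs" by (simp_all add: A_def)
    then have "Cs ! j \<noteq> Cs ! k"
      using Cs(2) jk(3) by (simp add: nth_eq_iff_index_eq)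
    then obtain i where i: "i < m" "(i \<in> Cs ! j) \<noteq> (i \<in> Cs ! k)"
      using sub[OF lt(1)] sub[OF lt(2)] by blast
    then have "cols A ! j $ i \<noteq> cols A ! k $ i"
      using lt by (auto simp: A_def)
    then show "cols A ! j \<noteq> cols A ! k" by metis
  qed
  moreover have "elements_mat A \<subseteq> {0, 1}"
    by (auto simp: elements_mat_def A_def)
  moreover have "column_sets A = F"
  proof -
    have "{i. i < dim_row A \<and> A $$ (i, j) = 1} = Cs ! j" if "j < length Cs" for j
      using sub[OF that] that by (auto simp: A_def split: if_splits)
    then have "column_sets A = (\<lambda>j. Cs ! j) ` {..<length Cs}"
      unfolding column_sets_def by (intro image_cong) (auto simp: A_def)
    also have "\<dots> = F"
      using Cs(1) by (auto simp: set_conv_nth)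
    finally show ?thesis .
  qed
  ultimately show ?thesis
    by (intro exI[of _ A]) (simp add: simple_matrix_def A_def)
qed

lemma dim_col_Avoid_eq_card_avoiding:
  "dim_col ` Avoid m (F0p10 p) = card ` {F. avoiding p {..<m} F}"
proof (intro equalityI subsetI)
  fix n assume "n \<in> dim_col ` Avoid m (F0p10 p)"
  then obtain A where A: "A \<in> Avoid m (F0p10 p)" "n = dim_col A" by blast
  then have simple: "simple_matrix A" by (simp add: Avoid_def)
  show "n \<in> card ` {F. avoiding p {..<m} F}"
    using A Avoid_iff_avoiding[OF simple] card_column_sets[OF simple]
    by (intro image_eqI[of _ _ "column_sets A"]) auto
next
  fix n assume "n \<in> card ` {F. avoiding p {..<m} F}"
  then obtain F where F: "avoiding p {..<m} F" "n = card F" by blast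
  then obtain A where A: "simple_matrix A" "dim_row A = m" "column_sets A = F"
    using exists_simple_matrix[of F m] unfolding avoiding_def by blast
  then show "n \<in> dim_col ` Avoid m (F0p10 p)"
    using F Avoid_iff_avoiding[OF A(1)] card_column_sets[OF A(1)]
    by (intro image_eqI[of _ _ A]) auto
qed

lemma forb_F0p10: "forb m (F0p10 p) = Max (card ` {F. avoiding p {..<m} F})"
  by (simp add: forb_def dim_col_Avoid_eq_card_avoiding)

lemma floor_21_5: "\<lfloor>(21 / 5 :: real) * real m\<rfloor> = int (4 * m + m div 5)"
proof -
  have "\<lfloor>(21 / 5 :: real) * real m\<rfloor> = \<lfloor>real (21 * m) / real 5\<rfloor>"
    by (simp add: mult.commute)
  also have "\<dots> = int (21 * m div 5)"
    by (rule floor_divide_of_nat_eq)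
  also have "21 * m div 5 = 4 * m + m div 5"
    by simp
  finally show ?thesis .
qed

theorem theorem1:
  shows "(\<forall>m::nat. m > 0 \<longrightarrow>
            int (forb m (F0p10 6)) \<le> \<lfloor>(21 / 5 :: real) * real m\<rfloor> + 1 \<and>
            (int (forb m (F0p10 6)) = \<lfloor>(21 / 5 :: real) * real m\<rfloor> + 1 \<longrightarrow> m mod 5 = 0)) \<and>
         (\<forall>m::nat. m \<ge> 6 \<and> m mod 5 = 1 \<longrightarrow>
            int (forb m (F0p10 6)) = \<lfloor>(21 / 5 :: real) * real m\<rfloor>)"
proof -
  have finite: "finite (card ` {F. avoiding 6 {..<m} F})" for m :: nat
    using finite_dim_col_Avoid[of m "F0p10 6"] by (simp only: dim_col_Avoid_eq_card_avoiding)
  have le: "forb m (F0p10 6) \<le> column_bound m" if "m > 0" for m :: nat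
    unfolding forb_F0p10
  proof (rule Max.boundedI[OF finite])
    have "Avoid m (F0p10 6) \<noteq> {}"
      by (rule Avoid_nonempty) (simp add: F0p10_def)
    then show "card ` {F. avoiding 6 {..<m} F} \<noteq> {}"
      unfolding dim_col_Avoid_eq_card_avoiding[symmetric] by simp
    fix n assume "n \<in> card ` {F. avoiding 6 {..<m} F}"
    then obtain F where "avoiding 6 {..<m} F" "n = card F" by blast
    then show "n \<le> column_bound m"
      using avoiding_card_le[of "{..<m}" F] that by (auto simp: lessThan_empty_iff)
  qed
  show ?thesis
  proof (intro conjI allI impI)
    fix m :: nat assume m: "m > 0"
    show "int (forb m (F0p10 6)) \<le> \<lfloor>(21 / 5 :: real) * real m\<rfloor> + 1"
      using le[OF m] unfolding floor_21_5 column_bound_def by (simp split: if_splits)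
    show "m mod 5 = 0" if "int (forb m (F0p10 6)) = \<lfloor>(21 / 5 :: real) * real m\<rfloor> + 1"
      using le[OF m] that unfolding floor_21_5 column_bound_def by (auto split: if_splits)
  next
    fix m :: nat assume m: "m \<ge> 6 \<and> m mod 5 = 1"
    \<comment> \<open>The number of blocks with 5 rows left after one with 6;
      \<open>m \<ge> 6\<close> keeps the subtraction from truncating.\<close>
    define k where "k = m div 5 - 1"
    have m_eq: "m = 5 * k + 6"
      using m div_mult_mod_eq[of m 5] unfolding k_def by linarith
    obtain F where F: "avoiding 6 {..<m} F" "card F = 21 * k + 25"
      using exists_avoiding_card[of k] m_eq by blast
    have "card F \<le> forb m (F0p10 6)"
      unfolding forb_F0p10 using finite F(1) by (intro Max_ge) auto
    moreover have "\<not> 5 dvd m" "m div 5 = k + 1"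
      using m_eq by presburger+
    ultimately show "int (forb m (F0p10 6)) = \<lfloor>(21 / 5 :: real) * real m\<rfloor>"
      using le[of m] F(2) m_eq unfolding floor_21_5 column_bound_def by simp
  qed
qed

end
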